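(* Let $\mathbf{p}(t)$ be a non-degenerate planar rational cubic Bézier curve with control points $\mathbf{c}_0,\dots,\mathbf{c}_3\in\mathbb{R}^2$ and real weights $w_0,\dots,w_3$, such that no three of the control points are collinear. Let $$K_0=L_{01}L_{12}L_{23},\quad K_1=L_{01}L_{13}^2,\quad K_2=L_{02}^2L_{23},\quad K_3=L_{03}^3,$$ and put $U=\prod_{k=0}^3 u_k$, $\Lambda=\prod_{k=0}^3\lambda_k$, $$b_0=-(\lambda_1^2\lambda_2^2U-u_1^2u_2^2\Lambda),\quad b_1=\lambda_1^3\lambda_3U-u_1^3u_3\Lambda,\quad b_2=\lambda_0\lambda_2^3U-u_0u_2^3\Lambda,\quad b_3=\lambda_0^2\lambda_3^2U-u_0^2u_3^2\Lambda .$$ Then the polynomial $$q(x,y)=\sum_{i=0}^3 b_iK_i(x,y)$$ defines the implicit representation $q(x,y)=0$ of the curve $\mathbf{p}$.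
   Context: For $\mathbf{c}_i=(c_{i,0},c_{i,1})\in\mathbb{R}^2$ and real weights $w_i$ ($i=0,1,2,3$), the rational cubic Bézier curve is $$\mathbf{p}(t)=\frac{\mathbf{c}_0w_0(1-t)^3+3\mathbf{c}_1w_1(1-t)^2t+3\mathbf{c}_2w_2(1-t)t^2+\mathbf{c}_3w_3t^3}{w_0(1-t)^3+3w_1(1-t)^2t+3w_2(1-t)t^2+w_3t^3},$$ and $u_i=\binom{3}{i}w_i$. Weights may be negative or zero unless stated otherwise. $L_{ij}(x,y)=\begin{vmatrix}x&y&1\\c_{i,0}&c_{i,1}&1\\c_{j,0}&c_{j,1}&1\end{vmatrix}$, $\lambda_{ijk}=\begin{vmatrix}c_{i,0}&c_{i,1}&1\\c_{j,0}&c_{j,1}&1\\c_{k,0}&c_{k,1}&1\end{vmatrix}$, and $\lambda_0=\lambda_{321}$, $\lambda_1=\lambda_{230}$, $\lambda_2=\lambda_{103}$, $\lambda_3=\lambda_{012}$. The curve is non-degenerate if it does not degenerate to a conic section or a line, i.e. no nonzero polynomial in $x,y$ of total degree at most $2$ vanishes identically on $\mathbf{p}(t)$. A polynomial $q$ defines the implicit representation of $\mathbf{p}$ if $q$ is a nonzero polynomial of least possible total degree such that $q(\mathbf{p}(t))=0$ identically in $t$. *)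

theory Defs
  imports "HOL-Analysis.Analysis" "HOL-Computational_Algebra.Polynomial"
begin

text \<open>
  A polynomial in \<open>x, y\<close> is an element of \<open>real poly poly\<close>: the outer indeterminate is \<open>y\<close>,
  the inner one is \<open>x\<close>, so \<open>coeff (coeff q j) i\<close> is the coefficient of \<open>x\<^sup>i y\<^sup>j\<close>.
\<close>

definition X_poly :: "real poly poly" where
  "X_poly = [:[:0, 1:]:]"

definition Y_poly :: "real poly poly" where
  "Y_poly = [:0, 1:]"

definition const2 :: "real \<Rightarrow> real poly poly" where
  "const2 a = [:[:a:]:]"

definition eval2 :: "real poly poly \<Rightarrow> real^2 \<Rightarrow> real" where
  "eval2 q v = poly (poly q [:v $ 2:]) (v $ 1)"

definition total_degree :: "real poly poly \<Rightarrow> nat" where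
  "total_degree q = (if q = 0 then 0 else Max {i + j |i j. coeff (coeff q j) i \<noteq> 0})"

definition bezier_denom :: "(nat \<Rightarrow> real) \<Rightarrow> real \<Rightarrow> real" where
  "bezier_denom w t = (\<Sum>i\<le>3. w i * Bernstein 3 i t)"

definition bezier :: "(nat \<Rightarrow> real^2) \<Rightarrow> (nat \<Rightarrow> real) \<Rightarrow> real \<Rightarrow> real^2" where
  "bezier c w t = (\<Sum>i\<le>3. (w i * Bernstein 3 i t) *\<^sub>R c i) /\<^sub>R bezier_denom w t"

text \<open>
  The identity \<open>q(p(t)) = 0\<close> is an identity of rational functions in \<open>t\<close>; parameters at which
  the denominator vanishes (where \<^const>\<open>bezier\<close> takes the junk value \<open>0\<close>) must be excluded.
  If all weights are zero, every \<open>q\<close> vanishes on the curve, which is therefore degenerate in the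
  sense below.
\<close>

definition vanishes_on_bezier ::
    "real poly poly \<Rightarrow> (nat \<Rightarrow> real^2) \<Rightarrow> (nat \<Rightarrow> real) \<Rightarrow> bool" where
  "vanishes_on_bezier q c w \<longleftrightarrow>
     (\<forall>t. bezier_denom w t \<noteq> 0 \<longrightarrow> eval2 q (bezier c w t) = 0)"

definition nondegenerate :: "(nat \<Rightarrow> real^2) \<Rightarrow> (nat \<Rightarrow> real) \<Rightarrow> bool" where
  "nondegenerate c w \<longleftrightarrow>
     \<not> (\<exists>q. q \<noteq> 0 \<and> total_degree q \<le> 2 \<and> vanishes_on_bezier q c w)"

definition implicit_representation ::
    "real poly poly \<Rightarrow> (nat \<Rightarrow> real^2) \<Rightarrow> (nat \<Rightarrow> real) \<Rightarrow> bool" where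
  "implicit_representation q c w \<longleftrightarrow>
     q \<noteq> 0 \<and> vanishes_on_bezier q c w \<and>
     (\<forall>r. r \<noteq> 0 \<longrightarrow> vanishes_on_bezier r c w \<longrightarrow> total_degree q \<le> total_degree r)"

definition L_poly :: "(nat \<Rightarrow> real^2) \<Rightarrow> nat \<Rightarrow> nat \<Rightarrow> real poly poly" where
  "L_poly c i j = det (vector [vector [X_poly, Y_poly, 1],
                          vector [const2 (c i $ 1), const2 (c i $ 2), 1],
                          vector [const2 (c j $ 1), const2 (c j $ 2), 1]]
                  :: real poly poly ^ 3 ^ 3)"

definition lam3 :: "(nat \<Rightarrow> real^2) \<Rightarrow> nat \<Rightarrow> nat \<Rightarrow> nat \<Rightarrow> real" where
  "lam3 c i j k = det (vector [vector [c i $ 1, c i $ 2, 1],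
                               vector [c j $ 1, c j $ 2, 1],
                               vector [c k $ 1, c k $ 2, 1]] :: real ^ 3 ^ 3)"

definition lam :: "(nat \<Rightarrow> real^2) \<Rightarrow> nat \<Rightarrow> real" where
  "lam c k = [lam3 c 3 2 1, lam3 c 2 3 0, lam3 c 1 0 3, lam3 c 0 1 2] ! k"

definition u_coef :: "(nat \<Rightarrow> real) \<Rightarrow> nat \<Rightarrow> real" where
  "u_coef w i = real (3 choose i) * w i"

definition K_poly :: "(nat \<Rightarrow> real^2) \<Rightarrow> nat \<Rightarrow> real poly poly" where
  "K_poly c i = [L_poly c 0 1 * L_poly c 1 2 * L_poly c 2 3,
            L_poly c 0 1 * (L_poly c 1 3)^2,
            (L_poly c 0 2)^2 * L_poly c 2 3,
            (L_poly c 0 3)^3] ! i"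

definition b_coef :: "(nat \<Rightarrow> real^2) \<Rightarrow> (nat \<Rightarrow> real) \<Rightarrow> nat \<Rightarrow> real" where
  "b_coef c w i =
    (let U = (\<Prod>k\<le>3. u_coef w k); \<Lambda> = (\<Prod>k\<le>3. lam c k) in
     [- ((lam c 1)^2 * (lam c 2)^2 * U - (u_coef w 1)^2 * (u_coef w 2)^2 * \<Lambda>),
      (lam c 1)^3 * lam c 3 * U - (u_coef w 1)^3 * u_coef w 3 * \<Lambda>,
      lam c 0 * (lam c 2)^3 * U - u_coef w 0 * (u_coef w 2)^3 * \<Lambda>,
      (lam c 0)^2 * (lam c 3)^2 * U - (u_coef w 0)^2 * (u_coef w 3)^2 * \<Lambda>] ! i)"

end

theory Submission
  imports Defs
begin

text \<open>
  Write \<open>s = 1 - t\<close>. In homogeneous coordinates the curve is \<open>\<Sum>k. u\<^sub>k s\<^bsup>3-k\<^esup> t\<^bsup>k\<^esup> C\<^sub>k\<close>, where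
  \<open>C\<^sub>k = (c\<^sub>k, 1)\<close>. Three things have to be shown.

  \<^item> \<open>q\<close> vanishes on the curve. Substituting the curve into \<open>L\<^sub>i\<^sub>j\<close> kills the terms \<open>k = i, j\<close>, so that
    only two terms remain and their coefficients are \<open>\<plusminus> u\<^sub>k \<lambda>\<^sub>l\<close>. What is left is a polynomial
    identity in \<open>s, t, u\<^sub>k, \<lambda>\<^sub>k\<close> alone (\<open>implicit_equation_identity\<close>).

  \<^item> \<open>q\<close> has least degree. Its degree is at most \<open>3\<close>, and non-degeneracy excludes every nonzero
    polynomial of degree at most \<open>2\<close>.

  \<^item> \<open>q\<close> is nonzero. If no three control points are collinear, the cubics \<open>K\<^sub>0, \<dots>, K\<^sub>3\<close> are linearly
    independent (\<open>K_combination_0_imp\<close>), so \<open>q = 0\<close> forces all \<open>b\<^sub>i = 0\<close>. With \<open>v\<^sub>k = u\<^sub>k / \<lambda>\<^sub>k\<close>, the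
    equations \<open>b\<^sub>i = 0\<close> say that \<open>v\<^sub>0 = v\<^sub>1 = 0\<close>, or \<open>v\<^sub>2 = v\<^sub>3 = 0\<close>, or \<open>v\<close> is a geometric progression
    with some ratio \<open>r\<close> (\<open>low_high_or_geometric\<close>). In the first two cases the homogeneous coordinates
    have the common factor \<open>t\<^sup>2\<close> or \<open>s\<^sup>2\<close>. In the third they have the common factor \<open>s - r t\<close>, because
    the parameter with \<open>s = r t\<close> gives a multiple of \<open>\<Sum>k. \<lambda>\<^sub>k C\<^sub>k\<close>, which is \<open>0\<close> by Cramer's rule
    (\<open>b_coef_0_imp_common_factor\<close>). After cancelling it the curve is parametrized by quadratics,
    hence lies on a conic (\<open>quadratic_parametrization_degenerate\<close>), contrary to non-degeneracy.
\<close>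

\<comment> \<open>Keeps the index \<open>1\<close> of control points and weights in the form in which the lemmas state it.\<close>
declare One_nat_def [simp del]

section \<open>Evaluation and degree of bivariate polynomials\<close>

lemma eval2_simps [simp]:
  "eval2 (p + q) v = eval2 p v + eval2 q v"
  "eval2 (p - q) v = eval2 p v - eval2 q v"
  "eval2 (p * q) v = eval2 p v * eval2 q v"
  "eval2 (p ^ n) v = eval2 p v ^ n"
  "eval2 0 v = 0"
  "eval2 X_poly v = v $ 1"
  "eval2 Y_poly v = v $ 2"
  "eval2 (const2 a) v = a"
  by (simp_all add: eval2_def X_poly_def Y_poly_def const2_def poly_power)

text \<open>
  The maximum in \<^const>\<open>total_degree\<close> is awkward under sums and products; a bound on the exponents
  of all occurring monomials is not, and it covers the zero polynomial uniformly.
\<close>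

definition total_degree_le :: "real poly poly \<Rightarrow> nat \<Rightarrow> bool" where
  "total_degree_le q n \<longleftrightarrow> (\<forall>i j. coeff (coeff q j) i \<noteq> 0 \<longrightarrow> i + j \<le> n)"

lemma total_degree_le_imp_total_degree:
  assumes "total_degree_le q n"
  shows "total_degree q \<le> n"
proof (cases "q = 0")
  case True
  then show ?thesis by (simp add: total_degree_def)
next
  case False
  let ?S = "{i + j |i j. coeff (coeff q j) i \<noteq> 0}"
  have sub: "?S \<subseteq> {..n}"
    using assms by (auto simp: total_degree_le_def)
  then have fin: "finite ?S"
    using finite_subset by blast
  from False obtain j where "coeff q j \<noteq> 0"
    by (metis leading_coeff_0_iff)
  then obtain i where "coeff (coeff q j) i \<noteq> 0"
    by (metis leading_coeff_0_iff)
  then have "?S \<noteq> {}" by blast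
  with fin sub have "Max ?S \<le> n" by (auto simp: Max_le_iff)
  with False show ?thesis by (simp add: total_degree_def)
qed

lemma total_degree_le_add:
  assumes "total_degree_le p n" and "total_degree_le q n"
  shows "total_degree_le (p + q) n"
  using assms unfolding total_degree_le_def by (metis add_0 coeff_add)

lemma total_degree_le_diff:
  assumes "total_degree_le p n" and "total_degree_le q n"
  shows "total_degree_le (p - q) n"
  using assms unfolding total_degree_le_def by (metis diff_zero coeff_diff)

lemma total_degree_le_mult:
  assumes p: "total_degree_le p m" and q: "total_degree_le q n"
  shows "total_degree_le (p * q) (m + n)"
  unfolding total_degree_le_def
proof (intro allI impI)
  fix i j
  assume "coeff (coeff (p * q) j) i \<noteq> 0"
  then have "(\<Sum>k\<le>j. \<Sum>l\<le>i. coeff (coeff p k) l * coeff (coeff q (j - k)) (i - l)) \<noteq> 0"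
    by (simp add: coeff_mult coeff_sum)
  then obtain k l where kl: "k \<le> j" "l \<le> i"
    and nz: "coeff (coeff p k) l \<noteq> 0" "coeff (coeff q (j - k)) (i - l) \<noteq> 0"
    by (metis (no_types, lifting) atMost_iff mult_eq_0_iff sum.neutral)
  have "l + k \<le> m" "(i - l) + (j - k) \<le> n"
    using p q nz unfolding total_degree_le_def by blast+
  with kl show "i + j \<le> m + n" by linarith
qed

lemma total_degree_le_const2: "total_degree_le (const2 a) n"
  by (auto simp: total_degree_le_def const2_def coeff_pCons split: nat.splits)

lemma total_degree_le_X: "total_degree_le X_poly 1"
  by (auto simp: total_degree_le_def X_poly_def coeff_pCons split: nat.splits)

lemma total_degree_le_Y: "total_degree_le Y_poly 1"
  by (auto simp: total_degree_le_def Y_poly_def coeff_pCons split: nat.splits)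

section \<open>The lines, the cubics and their combination\<close>

lemma L_poly_expand:
  "L_poly c i j = X_poly * const2 (c i $ 2 - c j $ 2) - Y_poly * const2 (c i $ 1 - c j $ 1)
     + const2 (c i $ 1 * c j $ 2 - c i $ 2 * c j $ 1)"
  by (simp add: L_poly_def det_3 vector_3 const2_def algebra_simps X_poly_def Y_poly_def)

lemma lam3_expand:
  "lam3 c i j k = c i $ 1 * (c j $ 2 - c k $ 2) - c i $ 2 * (c j $ 1 - c k $ 1)
     + (c j $ 1 * c k $ 2 - c j $ 2 * c k $ 1)"
  by (simp add: lam3_def det_3 vector_3 algebra_simps)

lemma eval2_L_poly:
  "eval2 (L_poly c i j) v = v $ 1 * (c i $ 2 - c j $ 2) - v $ 2 * (c i $ 1 - c j $ 1)
     + (c i $ 1 * c j $ 2 - c i $ 2 * c j $ 1)"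
  by (simp add: L_poly_expand)

lemma total_degree_le_L: "total_degree_le (L_poly c i j) 1"
proof -
  have "total_degree_le (P * const2 a) 1" if "total_degree_le P 1" for P a
    using total_degree_le_mult[OF that total_degree_le_const2[of a 0]] by simp
  then show ?thesis
    unfolding L_poly_expand
    by (blast intro: total_degree_le_add total_degree_le_diff total_degree_le_X total_degree_le_Y
        total_degree_le_const2)
qed

lemma lam_simps:
  "lam c 0 = lam3 c 3 2 1" "lam c 1 = lam3 c 2 3 0" "lam c 2 = lam3 c 1 0 3" "lam c 3 = lam3 c 0 1 2"
  by (simp_all add: lam_def numeral_2_eq_2 numeral_3_eq_3 One_nat_def)

lemma K_simps:
  "K_poly c 0 = L_poly c 0 1 * L_poly c 1 2 * L_poly c 2 3"
  "K_poly c 1 = L_poly c 0 1 * (L_poly c 1 3)^2"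
  "K_poly c 2 = (L_poly c 0 2)^2 * L_poly c 2 3"
  "K_poly c 3 = (L_poly c 0 3)^3"
  by (simp_all add: K_poly_def numeral_2_eq_2 numeral_3_eq_3 One_nat_def)

lemma sum_upto_3: "(\<Sum>i\<le>(3::nat). f i) = f 0 + f 1 + f 2 + (f 3 :: 'a::comm_monoid_add)"
  by (simp add: numeral_3_eq_3 numeral_2_eq_2 One_nat_def)

lemma prod_upto_3: "(\<Prod>i\<le>(3::nat). f i) = f 0 * f 1 * f 2 * (f 3 :: 'a::comm_monoid_mult)"
  by (simp add: numeral_3_eq_3 numeral_2_eq_2 One_nat_def)

definition K_combination :: "(nat \<Rightarrow> real^2) \<Rightarrow> (nat \<Rightarrow> real) \<Rightarrow> real poly poly" where
  "K_combination c b = (\<Sum>i\<le>3. const2 (b i) * K_poly c i)"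

lemma total_degree_le_K_combination: "total_degree_le (K_combination c b) 3"
proof -
  have L3: "total_degree_le (const2 a * (L_poly c i1 j1 * L_poly c i2 j2 * L_poly c i3 j3)) 3"
    for a i1 j1 i2 j2 i3 j3
    using total_degree_le_mult[OF total_degree_le_const2[of a 0]
        total_degree_le_mult[OF total_degree_le_mult[OF total_degree_le_L total_degree_le_L]
          total_degree_le_L]]
    by (simp add: numeral_3_eq_3)
  have "total_degree_le (const2 (b i) * K_poly c i) 3" if "i \<in> {0,1,2,3}" for i
    using that L3[of "b i"] by (auto simp: K_simps power2_eq_square power3_eq_cube mult.assoc)
  then show ?thesis
    unfolding K_combination_def sum_upto_3 by (intro total_degree_le_add) auto
qed

section \<open>The polynomial identity behind the implicit equation\<close>

text \<open>
  The factored forms are the values of the \<open>L\<^sub>i\<^sub>j\<close> on the curve in homogeneous coordinates. They treat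
  \<open>u\<close> and \<open>\<lambda>\<close> as independent quantities: the \<open>b\<^sub>i\<close> are made so that the products cancel without any
  relation between the control points.
\<close>

lemma implicit_equation_identity:
  fixes s t l0 l1 l2 l3 u0 u1 u2 u3 :: real
  defines "U \<equiv> u0 * u1 * u2 * u3" and "L \<equiv> l0 * l1 * l2 * l3"
  defines "L01 \<equiv> t^2 * (u2 * l3 * s - u3 * l2 * t)"
    and "L12 \<equiv> u0 * l3 * s^3 - u3 * l0 * t^3"
    and "L23 \<equiv> s^2 * (u0 * l1 * s - u1 * l0 * t)"
    and "L13 \<equiv> s * (u2 * l0 * t^2 - u0 * l2 * s^2)"
    and "L02 \<equiv> t * (u3 * l1 * t^2 - u1 * l3 * s^2)"
    and "L03 \<equiv> s * t * (u1 * l2 * s - u2 * l1 * t)"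
  shows "- (l1^2 * l2^2 * U - u1^2 * u2^2 * L) * (L01 * L12 * L23)
       + (l1^3 * l3 * U - u1^3 * u3 * L) * (L01 * L13^2)
       + (l0 * l2^3 * U - u0 * u2^3 * L) * (L02^2 * L23)
       + (l0^2 * l3^2 * U - u0^2 * u3^2 * L) * L03^3 = 0"
  unfolding assms by algebra

section \<open>Linear independence of the cubics\<close>

lemma lam3_table:
  "lam3 c 0 2 3 = lam c 1" "lam3 c 0 1 2 = lam c 3" "lam3 c 0 1 3 = - lam c 2"
  "lam3 c 0 0 k = 0"
  "lam3 c 1 0 1 = 0" "lam3 c 1 0 2 = - lam c 3" "lam3 c 1 0 3 = lam c 2" "lam3 c 1 2 3 = - lam c 0"
  "lam3 c 2 0 1 = lam c 3" "lam3 c 2 1 3 = lam c 0" "lam3 c 2 0 3 = - lam c 1"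
  "lam3 c 2 2 3 = 0"
  by (simp_all add: lam_simps lam3_expand algebra_simps)

lemma eval2_L_poly_control: "eval2 (L_poly c i j) (c k) = lam3 c k i j"
  by (simp add: eval2_L_poly lam3_expand algebra_simps)

text \<open>
  The reflection of one control point in another is a third point on the line through them, at which
  the values of the \<open>L\<^sub>i\<^sub>j\<close> follow from those at the two control points.
\<close>

lemma eval2_L_poly_reflect:
  "eval2 (L_poly c i j) (2 *\<^sub>R v - w) = 2 * eval2 (L_poly c i j) v - eval2 (L_poly c i j) w"
  by (simp add: eval2_L_poly algebra_simps)

text \<open>
  On the line through \<open>c\<^sub>0\<close> and \<open>c\<^sub>1\<close> only \<open>K\<^sub>2\<close> and \<open>K\<^sub>3\<close> survive. Both vanish at \<open>c\<^sub>0\<close>, to the orders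
  \<open>2\<close> and \<open>3\<close>, so they are independent on this line; two points of it, \<open>c\<^sub>1\<close> and the reflection of
  \<open>c\<^sub>0\<close> in \<open>c\<^sub>1\<close>, are enough to see this. Then \<open>c\<^sub>2\<close>, where \<open>K\<^sub>0\<close> vanishes and \<open>K\<^sub>1\<close> does not, gives
  \<open>b\<^sub>1 = 0\<close>, and \<open>K\<^sub>0\<close> remains as a product of nonzero polynomials.
\<close>

lemma K_combination_0_imp:
  assumes q: "K_combination c b = 0" and lam: "\<And>k. k \<le> 3 \<Longrightarrow> lam c k \<noteq> 0" and i: "i \<le> 3"
  shows "b i = 0"
proof -
  have nz: "lam c 0 \<noteq> 0" "lam c 1 \<noteq> 0" "lam c 2 \<noteq> 0" "lam c 3 \<noteq> 0"
    using lam by auto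
  have ev: "b 0 * eval2 (K_poly c 0) v + b 1 * eval2 (K_poly c 1) v + b 2 * eval2 (K_poly c 2) v
      + b 3 * eval2 (K_poly c 3) v = 0" for v
    using arg_cong[OF q, of "\<lambda>p. eval2 p v"] by (simp add: K_combination_def sum_upto_3)
  have e1: "b 3 * lam c 2 ^ 3 = b 2 * (lam c 3 ^ 2 * lam c 0)"
    using ev[of "c 1"]
    by (simp add: K_simps eval2_L_poly_control lam3_table)
  have e2: "b 2 * (4 * lam c 3 ^ 2 * (- 2 * lam c 0 - lam c 1)) + b 3 * (8 * lam c 2 ^ 3) = 0"
    using ev[of "2 *\<^sub>R c 1 - c 0"]
    by (simp add: K_simps eval2_L_poly_reflect eval2_L_poly_control lam3_table
        power_mult_distrib)
  have "b 2 * (lam c 3 ^ 2 * lam c 1) = 0"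
    using e1 e2 by algebra
  then have b2: "b 2 = 0" using nz by simp
  then have b3: "b 3 = 0" using e1 nz by simp
  have b1: "b 1 = 0"
    using ev[of "c 2"] nz b2 b3
    by (simp add: K_simps eval2_L_poly_control lam3_table)
  have "L_poly c 0 1 \<noteq> 0" "L_poly c 1 2 \<noteq> 0" "L_poly c 2 3 \<noteq> 0"
    using nz eval2_L_poly_control[of c 0 1 2] eval2_L_poly_control[of c 1 2 0]
      eval2_L_poly_control[of c 2 3 0]
    by (auto simp: lam3_table)
  then have "K_poly c 0 \<noteq> 0" by (simp add: K_simps)
  moreover have "const2 (b 0) * K_poly c 0 = 0"
    using q b1 b2 b3 by (simp add: K_combination_def sum_upto_3 const2_def)
  ultimately have b0: "b 0 = 0"
    by (simp add: const2_def)
  from i have "i \<in> {0,1,2,3}" by auto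
  with b0 b1 b2 b3 show ?thesis by auto
qed

section \<open>Homogeneous coordinates of the curve\<close>

text \<open>
  One homogeneous coordinate of the curve, where \<open>e k\<close> is that coordinate of the lifted control
  point \<open>(c k, 1)\<close>. Every linear form in the coordinates of the curve is again of this shape, which
  is how the values of the \<open>L\<^sub>i\<^sub>j\<close> are obtained.
\<close>

definition hom_coord :: "(nat \<Rightarrow> real) \<Rightarrow> (nat \<Rightarrow> real) \<Rightarrow> real \<Rightarrow> real" where
  "hom_coord w e t = u_coef w 0 * e 0 * (1 - t)^3 + u_coef w 1 * e 1 * ((1 - t)^2 * t)
     + u_coef w 2 * e 2 * ((1 - t) * t^2) + u_coef w 3 * e 3 * t^3"

lemma bezier_denom_hom: "bezier_denom w t = hom_coord w (\<lambda>_. 1) t"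
  by (simp add: bezier_denom_def sum_upto_3 hom_coord_def u_coef_def Bernstein_def
      numeral_3_eq_3 numeral_2_eq_2 One_nat_def)

lemma bezier_hom:
  assumes "bezier_denom w t \<noteq> 0"
  shows "bezier c w t $ i * bezier_denom w t = hom_coord w (\<lambda>k. c k $ i) t"
proof -
  have "bezier c w t $ i * bezier_denom w t = (\<Sum>k\<le>3. (w k * Bernstein 3 k t) *\<^sub>R c k) $ i"
    using assms by (simp add: bezier_def)
  also have "\<dots> = hom_coord w (\<lambda>k. c k $ i) t"
    by (simp add: sum_upto_3 hom_coord_def u_coef_def Bernstein_def
      numeral_3_eq_3 numeral_2_eq_2 One_nat_def)
  finally show ?thesis .
qed

text \<open>
  \<open>L\<^sub>i\<^sub>j\<close> is a linear form in homogeneous coordinates, with value \<open>\<lambda>\<^sub>k\<^sub>i\<^sub>j\<close> at the \<open>k\<close>-th control point.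
\<close>

lemma L_poly_on_bezier:
  assumes D: "bezier_denom w t \<noteq> 0"
  shows "bezier_denom w t * eval2 (L_poly c i j) (bezier c w t) = hom_coord w (\<lambda>k. lam3 c k i j) t"
proof -
  have "bezier_denom w t * eval2 (L_poly c i j) (bezier c w t)
      = (bezier c w t $ 1 * bezier_denom w t) * (c i $ 2 - c j $ 2)
        - (bezier c w t $ 2 * bezier_denom w t) * (c i $ 1 - c j $ 1)
        + bezier_denom w t * (c i $ 1 * c j $ 2 - c i $ 2 * c j $ 1)"
    by (simp add: eval2_L_poly algebra_simps)
  also have "\<dots> = hom_coord w (\<lambda>k. lam3 c k i j) t"
    unfolding bezier_hom[OF D] unfolding bezier_denom_hom hom_coord_def lam3_expand
    by (simp add: algebra_simps)
  finally show ?thesis .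
qed

section \<open>The combination vanishes on the curve\<close>

lemma b_coef_simps:
  defines "U \<equiv> \<lambda>w. u_coef w 0 * u_coef w 1 * u_coef w 2 * u_coef w 3"
    and "L \<equiv> \<lambda>c. lam c 0 * lam c 1 * lam c 2 * lam c 3"
  shows
  "b_coef c w 0 = - ((lam c 1)^2 * (lam c 2)^2 * U w - (u_coef w 1)^2 * (u_coef w 2)^2 * L c)"
  "b_coef c w 1 = (lam c 1)^3 * lam c 3 * U w - (u_coef w 1)^3 * u_coef w 3 * L c"
  "b_coef c w 2 = lam c 0 * (lam c 2)^3 * U w - u_coef w 0 * (u_coef w 2)^3 * L c"
  "b_coef c w 3 = (lam c 0)^2 * (lam c 3)^2 * U w - (u_coef w 0)^2 * (u_coef w 3)^2 * L c"
  by (simp_all only: b_coef_def Let_def prod_upto_3 U_def L_def)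
     (simp_all add: numeral_2_eq_2 numeral_3_eq_3 One_nat_def)

lemma K_combination_vanishes_on_bezier: "vanishes_on_bezier (K_combination c (b_coef c w)) c w"
  unfolding vanishes_on_bezier_def
proof (intro allI impI)
  fix t
  assume D: "bezier_denom w t \<noteq> 0"
  define d where "d = bezier_denom w t"
  define s where "s = 1 - t"
  define E where "E i j = eval2 (L_poly c i j) (bezier c w t)" for i j
  note on = L_poly_on_bezier[OF D, of c, folded d_def E_def]
  note tab = hom_coord_def s_def lam3_expand lam_simps
  have L: "d * E 0 1 = t^2 * (u_coef w 2 * lam c 3 * s - u_coef w 3 * lam c 2 * t)"
    "d * E 1 2 = u_coef w 0 * lam c 3 * s^3 - u_coef w 3 * lam c 0 * t^3"
    "d * E 2 3 = s^2 * (u_coef w 0 * lam c 1 * s - u_coef w 1 * lam c 0 * t)"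
    "d * E 1 3 = s * (u_coef w 2 * lam c 0 * t^2 - u_coef w 0 * lam c 2 * s^2)"
    "d * E 0 2 = t * (u_coef w 3 * lam c 1 * t^2 - u_coef w 1 * lam c 3 * s^2)"
    "d * E 0 3 = s * t * (u_coef w 1 * lam c 2 * s - u_coef w 2 * lam c 1 * t)"
    unfolding on tab by algebra+
  have "d^3 * eval2 (K_combination c (b_coef c w)) (bezier c w t)
     = b_coef c w 0 * ((d * E 0 1) * (d * E 1 2) * (d * E 2 3))
     + b_coef c w 1 * ((d * E 0 1) * (d * E 1 3)^2)
     + b_coef c w 2 * ((d * E 0 2)^2 * (d * E 2 3))
     + b_coef c w 3 * (d * E 0 3)^3"
    by (simp add: K_combination_def sum_upto_3 K_simps E_def power2_eq_square power3_eq_cube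
        algebra_simps)
  also have "\<dots> = 0"
    unfolding L b_coef_simps by (rule implicit_equation_identity)
  finally show "eval2 (K_combination c (b_coef c w)) (bezier c w t) = 0"
    using D by (simp add: d_def)
qed

section \<open>Curves with quadratic parametrization\<close>

lemma linear_kernel_nontrivial:
  fixes f :: "'a::euclidean_space \<Rightarrow> 'b::euclidean_space"
  assumes "linear f" and "DIM('b) < DIM('a)"
  obtains x where "x \<noteq> 0" "f x = 0"
proof -
  have "\<not> inj f"
  proof
    assume "inj f"
    then have "dim (range f) = DIM('a)"
      using dim_image_eq[OF \<open>linear f\<close>, of UNIV] by simp
    moreover have "dim (range f) \<le> DIM('b)" by (rule dim_subset_UNIV)
    ultimately show False using assms(2) by simp
  qed
  then show ?thesis
    using that linear_injective_0[OF \<open>linear f\<close>] by auto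
qed

text \<open>
  A dimension count: a quadratic form in three unknowns has six coefficients, while substituting
  polynomials of degree at most \<open>2\<close> gives a polynomial of degree at most \<open>4\<close>, which has only five.
  This treats lines and single points along with proper conics.
\<close>

lemma quadratics_satisfy_conic:
  fixes a b d :: "real poly"
  assumes deg: "degree a \<le> 2" "degree b \<le> 2" "degree d \<le> 2"
  obtains k0 k1 k2 k3 k4 k5 where "(k0, k1, k2, k3, k4, k5) \<noteq> 0"
    and "smult k0 (d * d) + smult k1 (a * d) + smult k2 (a * a)
       + smult k3 (b * d) + smult k4 (a * b) + smult k5 (b * b) = 0"
proof -
  define P where "P = (\<lambda>(k0, k1, k2, k3, k4, k5). smult k0 (d * d) + smult k1 (a * d)
    + smult k2 (a * a) + smult k3 (b * d) + smult k4 (a * b) + smult k5 (b * b))"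
  define f where "f k = (coeff (P k) 0, coeff (P k) 1, coeff (P k) 2, coeff (P k) 3, coeff (P k) 4)"
    for k
  have "linear f"
    by (rule linearI) (auto simp: f_def P_def algebra_simps)
  then obtain k where k: "k \<noteq> 0" "f k = 0"
    by (rule linear_kernel_nontrivial) simp
  obtain k0 k1 k2 k3 k4 k5 where kk: "k = (k0, k1, k2, k3, k4, k5)"
    by (metis prod.collapse)
  have d4: "degree (p * q) \<le> 4" if "degree p \<le> 2" "degree q \<le> 2" for p q :: "real poly"
    using degree_mult_le[of p q] that by simp
  have "degree (P k) \<le> 4"
    unfolding P_def kk prod.case
    by (intro degree_add_le order.trans[OF degree_smult_le] d4 deg)
  moreover have "coeff (P k) n = 0" if "n \<le> 4" for n
  proof -
    from that have "n \<in> {0,1,2,3,4}" by auto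
    then show ?thesis using k(2) by (auto simp: f_def zero_prod_def)
  qed
  ultimately have "P k = 0"
    by (metis coeff_eq_0 leading_coeff_0_iff)
  with k(1) show ?thesis
    using that unfolding kk P_def by auto
qed

text \<open>
  Where the denominator is nonzero the common factor \<open>g\<close> is nonzero too, so it cancels from the affine
  coordinates whatever it is. Hence \<open>g\<close> may be an arbitrary function.
\<close>

lemma quadratic_parametrization_degenerate:
  assumes deg: "degree a \<le> 2" "degree b \<le> 2" "degree d \<le> 2"
    and a: "\<And>t. hom_coord w (\<lambda>k. c k $ 1) t = g t * poly a t"
    and b: "\<And>t. hom_coord w (\<lambda>k. c k $ 2) t = g t * poly b t"
    and d: "\<And>t. hom_coord w (\<lambda>_. 1) t = g t * poly d t"
  shows "\<not> nondegenerate c w"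
proof -
  obtain k0 k1 k2 k3 k4 k5 where k: "(k0, k1, k2, k3, k4, k5) \<noteq> 0"
    and conic: "smult k0 (d * d) + smult k1 (a * d) + smult k2 (a * a)
       + smult k3 (b * d) + smult k4 (a * b) + smult k5 (b * b) = 0"
    using quadratics_satisfy_conic[OF deg] by blast
  define q where "q = [:[:k0, k1, k2:], [:k3, k4:], [:k5:]:]"
  have "q \<noteq> 0" using k by (auto simp: q_def zero_prod_def)
  moreover have "total_degree q \<le> 2"
    by (rule total_degree_le_imp_total_degree)
      (auto simp: total_degree_le_def q_def coeff_pCons split: nat.splits)
  moreover have "vanishes_on_bezier q c w"
    unfolding vanishes_on_bezier_def
  proof (intro allI impI)
    fix t
    assume D: "bezier_denom w t \<noteq> 0"
    define x y where "x = bezier c w t $ 1" and "y = bezier c w t $ 2"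
    have gd: "g t \<noteq> 0" "poly d t \<noteq> 0"
      using D by (auto simp: bezier_denom_hom d)
    have xy: "poly a t = x * poly d t" "poly b t = y * poly d t"
      using bezier_hom[OF D, of c 1] bezier_hom[OF D, of c 2] gd
      by (simp_all add: bezier_denom_hom a b d x_def y_def)
    have "eval2 q (bezier c w t) = k0 + k1 * x + k2 * x^2 + k3 * y + k4 * x * y + k5 * y^2"
      by (simp add: q_def eval2_def flip: x_def y_def)
         (simp add: algebra_simps power2_eq_square)
    moreover have "(k0 + k1 * x + k2 * x^2 + k3 * y + k4 * x * y + k5 * y^2) * (poly d t)^2 = 0"
      using arg_cong[OF conic, of "\<lambda>p. poly p t"]
      by (simp add: xy algebra_simps power2_eq_square del: mult_eq_0_iff)
    ultimately have "eval2 q (bezier c w t) * (poly d t)^2 = 0"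
      by simp
    then show "eval2 q (bezier c w t) = 0"
      using gd by simp
  qed
  ultimately show ?thesis unfolding nondegenerate_def by blast
qed

section \<open>Vanishing coefficients force a common factor\<close>

text \<open>
  The four equations are \<open>b\<^sub>i = 0\<close> in terms of \<open>v\<^sub>k = u\<^sub>k / \<lambda>\<^sub>k\<close>. If the product of the \<open>v\<^sub>k\<close> is nonzero,
  cancelling gives \<open>v\<^sub>0 v\<^sub>2 = v\<^sub>1\<^sup>2\<close> and \<open>v\<^sub>0 v\<^sub>3 = v\<^sub>1 v\<^sub>2\<close>. Otherwise all four right-hand sides are zero.
\<close>

lemma low_high_or_geometric:
  fixes v0 v1 v2 v3 :: real
  assumes "v0 * v1 * v2 * v3 = v1^2 * v2^2" "v0 * v1 * v2 * v3 = v1^3 * v3"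
    "v0 * v1 * v2 * v3 = v0 * v2^3" "v0 * v1 * v2 * v3 = v0^2 * v3^2"
  shows "v0 = 0 \<and> v1 = 0 \<or> v2 = 0 \<and> v3 = 0 \<or> (\<exists>r. v1 = v0 * r \<and> v2 = v0 * r^2 \<and> v3 = v0 * r^3)"
proof (cases "v0 * v1 * v2 * v3 = 0")
  case True
  then show ?thesis using assms by auto
next
  case False
  then have nz: "v0 \<noteq> 0" "v1 \<noteq> 0" "v2 \<noteq> 0" "v3 \<noteq> 0" by auto
  have v2: "v0 * v2 = v1^2"
  proof -
    have "v1 * v3 * (v0 * v2) = v1 * v3 * v1^2"
      using assms(2) by (simp add: power2_eq_square power3_eq_cube mult_ac)
    then show ?thesis using nz by simp
  qed
  have v3: "v0 * v3 = v1 * v2"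
  proof -
    have "v1 * v2 * (v0 * v3) = v1 * v2 * (v1 * v2)"
      using assms(1) by (simp add: power2_eq_square mult_ac)
    then show ?thesis using nz by simp
  qed
  define r where "r = v1 / v0"
  have 1: "v1 = v0 * r" using nz by (simp add: r_def)
  have 2: "v2 = v0 * r^2"
    using v2 nz unfolding 1 by (simp add: power2_eq_square mult_ac)
  have "v3 = v0 * r^3"
    using v3 nz unfolding 1 2 by (simp add: power2_eq_square power3_eq_cube mult_ac)
  with 1 2 show ?thesis by blast
qed

text \<open>
  The factor \<open>g\<close> must be the same for all three homogeneous coordinates of the curve, so it is chosen
  before \<open>e\<close>. The hypothesis on \<open>e\<close> is the linear relation that the lifted control points satisfy.
\<close>

lemma b_coef_0_imp_common_factor:
  assumes lam: "\<And>k. k \<le> 3 \<Longrightarrow> lam c k \<noteq> 0"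
    and b: "\<And>i. i \<le> 3 \<Longrightarrow> b_coef c w i = 0"
  obtains g where "\<And>e. lam c 0 * e 0 + lam c 1 * e 1 + lam c 2 * e 2 + lam c 3 * e 3 = 0
    \<Longrightarrow> \<exists>a. degree a \<le> 2 \<and> (\<forall>t. hom_coord w e t = g t * poly a t)"
proof -
  have nz: "lam c 0 \<noteq> 0" "lam c 1 \<noteq> 0" "lam c 2 \<noteq> 0" "lam c 3 \<noteq> 0"
    using lam by auto
  define v where "v k = u_coef w k / lam c k" for k
  have u: "u_coef w 0 = v 0 * lam c 0" "u_coef w 1 = v 1 * lam c 1"
    "u_coef w 2 = v 2 * lam c 2" "u_coef w 3 = v 3 * lam c 3"
    using nz by (simp_all add: v_def)
  define L where "L = lam c 0 * lam c 1 * lam c 2 * lam c 3"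
  have "L \<noteq> 0" using nz by (simp add: L_def)
  have "lam c 1 ^ 2 * lam c 2 ^ 2 * L * (v 0 * v 1 * v 2 * v 3 - v 1 ^ 2 * v 2 ^ 2) = 0"
    using b[of 0] unfolding b_coef_simps u L_def by simp algebra
  moreover have "lam c 1 ^ 3 * lam c 3 * L * (v 0 * v 1 * v 2 * v 3 - v 1 ^ 3 * v 3) = 0"
    using b[of 1] unfolding b_coef_simps u L_def by simp algebra
  moreover have "lam c 0 * lam c 2 ^ 3 * L * (v 0 * v 1 * v 2 * v 3 - v 0 * v 2 ^ 3) = 0"
    using b[of 2] unfolding b_coef_simps u L_def by simp algebra
  moreover have "lam c 0 ^ 2 * lam c 3 ^ 2 * L * (v 0 * v 1 * v 2 * v 3 - v 0 ^ 2 * v 3 ^ 2) = 0"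
    using b[of 3] unfolding b_coef_simps u L_def by simp algebra
  ultimately have "v 0 = 0 \<and> v 1 = 0 \<or> v 2 = 0 \<and> v 3 = 0
      \<or> (\<exists>r. v 1 = v 0 * r \<and> v 2 = v 0 * r^2 \<and> v 3 = v 0 * r^3)"
    using nz \<open>L \<noteq> 0\<close> by (intro low_high_or_geometric) auto
  then consider (low) "v 0 = 0" "v 1 = 0" | (high) "v 2 = 0" "v 3 = 0"
    | (geometric) r where "v 1 = v 0 * r" "v 2 = v 0 * r^2" "v 3 = v 0 * r^3"
    by blast
  then show ?thesis
  proof cases
    case low
    show ?thesis
    proof (rule that[of "\<lambda>t. t^2"])
      fix e :: "nat \<Rightarrow> real"
      let ?a = "[:u_coef w 2 * e 2, u_coef w 3 * e 3 - u_coef w 2 * e 2:]"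
      have "hom_coord w e t = t^2 * poly ?a t" for t
        unfolding hom_coord_def u low by (simp add: algebra_simps power2_eq_square power3_eq_cube)
      moreover have "degree ?a \<le> 2" by simp
      ultimately show "\<exists>a. degree a \<le> 2 \<and> (\<forall>t. hom_coord w e t = t^2 * poly a t)"
        by blast
    qed
  next
    case high
    show ?thesis
    proof (rule that[of "\<lambda>t. (1 - t)^2"])
      fix e :: "nat \<Rightarrow> real"
      let ?a = "[:u_coef w 0 * e 0, u_coef w 1 * e 1 - u_coef w 0 * e 0:]"
      have "hom_coord w e t = (1 - t)^2 * poly ?a t" for t
        unfolding hom_coord_def u high by (simp add: algebra_simps power2_eq_square power3_eq_cube)
      moreover have "degree ?a \<le> 2" by simp
      ultimately show "\<exists>a. degree a \<le> 2 \<and> (\<forall>t. hom_coord w e t = (1 - t)^2 * poly a t)"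
        by blast
    qed
  next
    case geometric
    show ?thesis
    proof (rule that[of "\<lambda>t. v 0 * (1 - t - r * t)"])
      fix e :: "nat \<Rightarrow> real"
      assume rel: "lam c 0 * e 0 + lam c 1 * e 1 + lam c 2 * e 2 + lam c 3 * e 3 = 0"
      define f where "f k = lam c k * e k" for k
      have f3: "f 3 = - f 0 - f 1 - f 2" using rel by (simp add: f_def)
      \<comment> \<open>Replacing \<open>f 3\<close> turns the cubic into \<open>f 0 (s\<^sup>3 - \<tau>\<^sup>3) + f 1 (s\<^sup>2 \<tau> - \<tau>\<^sup>3) + f 2 (s \<tau>\<^sup>2 - \<tau>\<^sup>3)\<close> with
        \<open>s = 1 - t\<close> and \<open>\<tau> = r t\<close>; \<open>?a\<close> is the quotient by \<open>s - \<tau>\<close>, expanded in \<open>t\<close>.\<close>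
      let ?a = "[:f 0, f 0 * (r - 2) + f 1 * r, f 0 * (1 - r + r^2) + f 1 * (r^2 - r) + f 2 * r^2:]"
      have "hom_coord w e t = v 0 * (1 - t - r * t) * poly ?a t" for t
      proof -
        have "hom_coord w e t = v 0 * (f 0 * (1 - t)^3 + f 1 * ((1 - t)^2 * (r * t))
            + f 2 * ((1 - t) * (r * t)^2) + f 3 * (r * t)^3)"
          unfolding hom_coord_def u geometric f_def by algebra
        also have "\<dots> = v 0 * (1 - t - r * t) * poly ?a t"
          unfolding f3 by simp algebra
        finally show ?thesis .
      qed
      moreover have "degree ?a \<le> 2" by simp
      ultimately show "\<exists>a. degree a \<le> 2 \<and> (\<forall>t. hom_coord w e t = v 0 * (1 - t - r * t) * poly a t)"
        by blast
    qed
  qed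
qed

lemma b_coef_0_imp_degenerate:
  assumes lam: "\<And>k. k \<le> 3 \<Longrightarrow> lam c k \<noteq> 0"
    and b: "\<And>i. i \<le> 3 \<Longrightarrow> b_coef c w i = 0"
  shows "\<not> nondegenerate c w"
proof -
  obtain g where g: "\<And>e. lam c 0 * e 0 + lam c 1 * e 1 + lam c 2 * e 2 + lam c 3 * e 3 = 0
    \<Longrightarrow> \<exists>a. degree a \<le> 2 \<and> (\<forall>t. hom_coord w e t = g t * poly a t)"
    using b_coef_0_imp_common_factor[of c w] lam b by blast
  \<comment> \<open>Cramer's rule for the four lifted control points in three-dimensional space.\<close>
  have rel: "lam c 0 * c 0 $ 1 + lam c 1 * c 1 $ 1 + lam c 2 * c 2 $ 1 + lam c 3 * c 3 $ 1 = 0"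
    "lam c 0 * c 0 $ 2 + lam c 1 * c 1 $ 2 + lam c 2 * c 2 $ 2 + lam c 3 * c 3 $ 2 = 0"
    "lam c 0 * 1 + lam c 1 * 1 + lam c 2 * 1 + lam c 3 * 1 = 0"
    unfolding lam_simps lam3_expand by algebra+
  from g[OF rel(1)] g[OF rel(2)] g[OF rel(3)] show ?thesis
    using quadratic_parametrization_degenerate by blast
qed

section \<open>The implicit equation\<close>

lemma lam3_0_imp_collinear:
  assumes "lam3 c i j k = 0"
  shows "collinear {c i, c j, c k}"
proof -
  define x y where "x = c i - c j" and "y = c k - c j"
  have det: "x $ 1 * y $ 2 = x $ 2 * y $ 1"
    using assms by (simp add: lam3_expand x_def y_def algebra_simps)
  have "\<exists>r. y = r *\<^sub>R x" if "x \<noteq> 0"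
  proof (cases "x $ 1 = 0")
    case True
    then have "x $ 2 \<noteq> 0" using that by (auto simp: vec_eq_iff forall_2)
    then have "y = (y $ 2 / x $ 2) *\<^sub>R x"
      using det by (simp add: vec_eq_iff forall_2 field_simps)
    then show ?thesis ..
  next
    case False
    then have "y = (y $ 1 / x $ 1) *\<^sub>R x"
      using det by (simp add: vec_eq_iff forall_2 field_simps)
    then show ?thesis ..
  qed
  then have "collinear {0, x, y}" unfolding collinear_lemma by blast
  then show ?thesis by (simp add: collinear_3 x_def y_def)
qed

theorem theorem1:
  fixes c :: "nat \<Rightarrow> real^2" and w :: "nat \<Rightarrow> real"
  assumes "nondegenerate c w"
    and "\<And>i j k. i < j \<Longrightarrow> j < k \<Longrightarrow> k \<le> 3 \<Longrightarrow> \<not> collinear {c i, c j, c k}"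
  shows "implicit_representation (\<Sum>i\<le>3. const2 (b_coef c w i) * K_poly c i) c w"
proof -
  let ?q = "K_combination c (b_coef c w)"
  have nz: "lam3 c i j k \<noteq> 0" if "i < j" "j < k" "k \<le> 3" for i j k
    using assms(2)[OF that] lam3_0_imp_collinear by blast
  have "lam c k \<noteq> 0" if "k \<le> 3" for k
  proof -
    from that have "k \<in> {0,1,2,3}" by auto
    then show ?thesis
      using nz[of 0 1 2] nz[of 0 1 3] nz[of 0 2 3] nz[of 1 2 3]
      by (auto simp: lam3_table)
  qed
  then have "?q \<noteq> 0"
    using K_combination_0_imp[of c "b_coef c w"] b_coef_0_imp_degenerate[of c w] assms(1) by blast
  moreover have "total_degree ?q \<le> total_degree r"
    if "r \<noteq> 0" "vanishes_on_bezier r c w" for r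
  proof -
    have "\<not> total_degree r \<le> 2"
      using assms(1) that unfolding nondegenerate_def by blast
    then show ?thesis
      using total_degree_le_imp_total_degree[OF total_degree_le_K_combination[of c "b_coef c w"]]
      by linarith
  qed
  ultimately show ?thesis
    using K_combination_vanishes_on_bezier
    unfolding implicit_representation_def K_combination_def by blast
qed

end
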